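(* Let $X$ be a normed space, and let $\mathcal{C}$ and $\mathcal{K}$ be co-radiant subsets of $X$ such that $d_{\mathcal{C}}\, d_{\mathcal{K}} > 0$, $\mathcal{K}$ admits a norm base, and $\overline{\mathrm{co}}(\mathcal{C})\cap\mathcal{K}\neq\emptyset$. Consider the following assertions: (i) The pair $(\mathrm{cone}(\mathcal{C}), \mathrm{cone}(\mathcal{K}))$ satisfies the SSP. (ii) There exist $\alpha_1, \alpha_2 \in \mathbb{R}$ with $0 < \alpha_1 < \alpha_2$, and $f \in S_{X^*}$ such that: (a) $\lambda := \inf\{ f(y) - \alpha \| y \| : y \in \mathcal{C},\ \alpha \in (\alpha_1, \alpha_2) \} > 0$; (b) for every $0 < \eta < \frac{\lambda}{I_{\mathcal{K}}}$, the inequalities $$f(y') - \alpha \| y' \| < \lambda < f(y) - \alpha \| y \|$$ hold for all $\alpha \in (\alpha_1, \alpha_2)$, $y' \in X\setminus\mathrm{int}(\mathcal{K}(\eta))$, and $y \in \overline{\mathrm{co}}(\mathcal{C})$. Then (i) $\Rightarrow$ (ii). Moreover, if $\mathcal{C}$ also admits a norm base, then (ii) $\Rightarrow$ (i).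
   Context: $X$ is a real normed space with zero $0_X$, dual $X^*$ with dual norm $\|\cdot\|_*$, unit sphere $S_X=\{x:\|x\|=1\}$, and $S_{X^*}=\{f\in X^*:\|f\|_*=1\}$. For $S\subset X$, $\overline S$, $\mathrm{bd}(S)$, $\mathrm{int}(S)$, $\mathrm{co}(S)$, $\overline{\mathrm{co}}(S)$ denote the closure, boundary, interior, convex hull, and closure of the convex hull. Cone: a set $C\subset X$ with $\lambda x\in C$ for all $\lambda\ge 0$, $x\in C$. For $S\subset X$, $\mathrm{cone}(S)=\{\lambda s:\lambda\ge0,\ s\in S\}$. Co-radiant set: a set $\mathcal{C}\subset X$ with $\lambda x\in\mathcal{C}$ for all $\lambda\ge1$, $x\in\mathcal{C}$; all co-radiant sets are assumed proper, i.e. $\mathcal{C}\neq\emptyset$ and $\mathcal{C}\ne X$. For $\varepsilon>0$, $\mathcal{C}(\varepsilon):=\varepsilon\,\mathcal{C}$. $d_{\mathcal{C}}:=\inf\{\|c\|:c\in\mathcal{C}\}\ge 0$. Norm base: for $t>0$ put $\mathcal{C}_t:=\mathcal{C}\cap tS_X$. $\mathcal{C}_t$ is a norm base of $\mathcal{C}$ (with radius $t$) if for every $y\in\mathcal{C}$ there exist $\lambda>0$ and $y_t\in\mathcal{C}_t$ with $y=\lambda y_t$. $\mathcal{C}$ admits a norm base if $\mathcal{C}_t$ is a norm base of $\mathcal{C}$ for some $t>0$; in that case $I_{\mathcal{C}}:=\inf\{t>0:\mathcal{C}_t\text{ is a norm base of }\mathcal{C}\}$. SSP (strict separation property): a pair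 of cones $(C,K)$ in $X$ satisfies the SSP if $0_X\notin\overline{\mathrm{co}(C\cap S_X)-\mathrm{co}\big((\mathrm{bd}(K)\cap S_X)\cup\{0_X\}\big)}$. *)

theory Defs
  imports "HOL-Analysis.Analysis"
begin

definition generated_cone :: "'a::real_vector set \<Rightarrow> 'a set" where
  "generated_cone S = {l *\<^sub>R s | l s. 0 \<le> l \<and> s \<in> S}"

text \<open>Co-radiant sets are proper by convention (neither empty nor the whole space).\<close>

definition co_radiant :: "'a::real_vector set \<Rightarrow> bool" where
  "co_radiant C \<longleftrightarrow>
     (\<forall>l\<ge>1. \<forall>x\<in>C. l *\<^sub>R x \<in> C) \<and> C \<noteq> {} \<and> C \<noteq> UNIV"

definition scaled :: "'a::real_vector set \<Rightarrow> real \<Rightarrow> 'a set" where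
  "scaled C e = (\<lambda>x. e *\<^sub>R x) ` C"

definition dist_zero :: "'a::real_normed_vector set \<Rightarrow> real" where
  "dist_zero C = (INF c\<in>C. norm c)"

definition norm_base :: "'a::real_normed_vector set \<Rightarrow> real \<Rightarrow> bool" where
  "norm_base C t \<longleftrightarrow>
     0 < t \<and> (\<forall>y\<in>C. \<exists>l>0. \<exists>z\<in>C \<inter> sphere 0 t. y = l *\<^sub>R z)"

definition admits_norm_base :: "'a::real_normed_vector set \<Rightarrow> bool" where
  "admits_norm_base C \<longleftrightarrow> (\<exists>t. norm_base C t)"

text \<open>Meaningful only for sets that admit a norm base.\<close>

definition norm_base_inf :: "'a::real_normed_vector set \<Rightarrow> real" where
  "norm_base_inf C = Inf {t. norm_base C t}"

text \<open>Strict separation property. The set below is the Minkowski difference;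
  the infix minus on sets would be the set-theoretic one.\<close>

definition SSP :: "'a::real_normed_vector set \<Rightarrow> 'a set \<Rightarrow> bool" where
  "SSP C K \<longleftrightarrow> cone C \<and> cone K \<and>
     0 \<notin> closure {a - b | a b.
            a \<in> convex hull (C \<inter> sphere 0 1) \<and>
            b \<in> convex hull ((frontier K \<inter> sphere 0 1) \<union> {0})}"

definition separation_values ::
  "('a::real_normed_vector \<Rightarrow>\<^sub>L real) \<Rightarrow> 'a set \<Rightarrow> real \<Rightarrow> real \<Rightarrow> real set" where
  "separation_values f C a1 a2 =
     {blinfun_apply f y - a * norm y | y a. y \<in> C \<and> a \<in> {a1<..<a2}}"

text \<open>Boundedness below is explicit because the real-valued \<^const>\<open>Inf\<close> of a set that is
  unbounded below is an unspecified number, not minus infinity.\<close>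

definition conically_separated :: "'a::real_normed_vector set \<Rightarrow> 'a set \<Rightarrow> bool" where
  "conically_separated C K \<longleftrightarrow>
     (\<exists>a1 a2 :: real. \<exists>f :: 'a \<Rightarrow>\<^sub>L real. \<exists>lam :: real.
        0 < a1 \<and> a1 < a2 \<and> norm f = 1 \<and>
        bdd_below (separation_values f C a1 a2) \<and>
        lam = Inf (separation_values f C a1 a2) \<and> 0 < lam \<and>
        (\<forall>eta. 0 < eta \<and> eta < lam / norm_base_inf K \<longrightarrow>
           (\<forall>a\<in>{a1<..<a2}. \<forall>y'\<in>UNIV - interior (scaled K eta). \<forall>y\<in>closure (convex hull C).
              blinfun_apply f y' - a * norm y' < lam \<and>
              lam < blinfun_apply f y - a * norm y)))"

end

theory Submission imports Defs begin

text \<open>For (i) implies (ii), the Hahn--Banach theorem turns the SSP into a unit functional \<open>f\<close> and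
  \<open>s \<ge> 0\<close>, \<open>d > 0\<close> with \<open>f x \<ge> (s + d) \<parallel>x\<parallel>\<close> on the cone of \<open>C\<close> and \<open>f x \<le> s \<parallel>x\<parallel>\<close> on the frontier
  of the cone of \<open>K\<close>; any \<open>s < a1 < a2 < s + d\<close> will do. Since \<open>f - a \<parallel>\<cdot>\<parallel>\<close> is concave and
  positive at a point of \<open>K\<close>, it is nonpositive everywhere outside the interior of the cone of \<open>K\<close>.
  A point in that interior but not in the interior of \<open>eta K\<close> has norm below \<open>lam\<close>, because a norm
  base of radius \<open>t\<close> forces \<open>K\<close> to contain all points of its cone of norm at least \<open>t\<close>.
  For (ii) implies (i), rescaling points of the cones gives \<open>f \<ge> a2 \<parallel>\<cdot>\<parallel>\<close> on the cone of \<open>C\<close> and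
  \<open>f \<le> a1 \<parallel>\<cdot>\<parallel>\<close> on the frontier of the cone of \<open>K\<close>.\<close>

section \<open>Sublinear functionals and strict separation\<close>

definition sublinear :: "('a::real_vector \<Rightarrow> real) \<Rightarrow> bool" where
  "sublinear q \<longleftrightarrow> (\<forall>x y. q (x + y) \<le> q x + q y) \<and> (\<forall>c\<ge>0. \<forall>x. q (c *\<^sub>R x) = c * q x)"

lemma sublinear_add: "sublinear q \<Longrightarrow> q (x + y) \<le> q x + q y"
  by (simp add: sublinear_def)

lemma sublinear_scale: "sublinear q \<Longrightarrow> 0 \<le> c \<Longrightarrow> q (c *\<^sub>R x) = c * q x"
  by (simp add: sublinear_def)

lemma sublinear_zero: "sublinear q \<Longrightarrow> q 0 = 0"
  using sublinear_scale[of q 0 0] by simp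

lemma sublinear_minus_le: "sublinear q \<Longrightarrow> - q (- x) \<le> q x"
  using sublinear_add[of q x "- x"] by (simp add: sublinear_zero)

text \<open>One inequality for positive scalars suffices: applied to \<open>inverse c\<close> and
  \<open>c *\<^sub>R x\<close> it yields the reverse one.\<close>

lemma sublinearI:
  assumes add: "\<And>x y. q (x + y) \<le> q x + q y"
    and scale: "\<And>c x. 0 < c \<Longrightarrow> q (c *\<^sub>R x) \<le> c * q x"
    and zero: "q 0 \<le> 0"
  shows "sublinear q"
proof -
  have "q (c *\<^sub>R x) = c * q x" if "0 \<le> c" for c x
  proof (cases "c = 0")
    case True
    then show ?thesis using zero add[of 0 0] by simp
  next
    case False
    with that have c: "0 < c" by simp
    have "q x \<le> inverse c * q (c *\<^sub>R x)"
      using scale[of "inverse c" "c *\<^sub>R x"] c by simp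
    then have "c * q x \<le> q (c *\<^sub>R x)"
      using c by (simp add: field_simps)
    with scale[OF c, of x] show ?thesis by simp
  qed
  with add show ?thesis by (simp add: sublinear_def)
qed

text \<open>Subadditivity survives the infimum because two members of a chain can both be replaced
  by the smaller one. This supplies the lower bounds of chains for Zorn's lemma.\<close>

lemma sublinear_INF_chain:
  fixes M :: "('a::real_vector \<Rightarrow> real) set"
  assumes ne: "M \<noteq> {}" and sub: "\<And>q. q \<in> M \<Longrightarrow> sublinear q"
    and chain: "\<And>q r. q \<in> M \<Longrightarrow> r \<in> M \<Longrightarrow> q \<le> r \<or> r \<le> q"
    and bdd: "\<And>x. bdd_below ((\<lambda>q. q x) ` M)"
  shows "sublinear (\<lambda>x. INF q\<in>M. q x)"
proof (rule sublinearI)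
  let ?u = "\<lambda>x. INF q\<in>M. q x"
  have lower: "?u x \<le> q x" if "q \<in> M" for q x
    using that bdd by (rule cINF_lower[rotated])
  show "?u (x + y) \<le> ?u x + ?u y" for x y
  proof -
    have "?u (x + y) \<le> q x + r y" if qr: "q \<in> M" "r \<in> M" for q r
    proof -
      obtain s where s: "s \<in> M" "s x \<le> q x" "s y \<le> r y"
        using chain[OF qr] qr by (auto simp: le_fun_def)
      have "?u (x + y) \<le> s (x + y)" using s(1) by (rule lower)
      also have "\<dots> \<le> s x + s y" using sub[OF s(1)] by (rule sublinear_add)
      finally show ?thesis using s by linarith
    qed
    then have "?u (x + y) - r y \<le> ?u x" if "r \<in> M" for r
      using that by (intro cINF_greatest[OF ne]) (simp add: diff_le_eq)
    then have "?u (x + y) - ?u x \<le> ?u y"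
      by (intro cINF_greatest[OF ne]) (smt (verit))
    then show ?thesis by simp
  qed
  show "?u (c *\<^sub>R x) \<le> c * ?u x" if c: "0 < c" for c x
  proof -
    have "?u (c *\<^sub>R x) / c \<le> q x" if "q \<in> M" for q
      using lower[OF that, of "c *\<^sub>R x"] sublinear_scale[OF sub[OF that], of c x] c
      by (simp add: field_simps)
    then have "?u (c *\<^sub>R x) / c \<le> ?u x" by (intro cINF_greatest[OF ne])
    then show ?thesis using c by (simp add: field_simps)
  qed
  obtain q where "q \<in> M" using ne by blast
  then show "?u 0 \<le> 0"
    using lower[of q 0] sublinear_zero[OF sub[of q]] by simp
qed

lemma exists_minimal_sublinear:
  fixes p :: "'a::real_vector \<Rightarrow> real"
  assumes p: "sublinear p"
  obtains m where "sublinear m" "m \<le> p" "\<And>q. sublinear q \<Longrightarrow> q \<le> m \<Longrightarrow> q = m"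
proof -
  let ?A = "{q. sublinear q \<and> q \<le> p}"
  have "\<exists>m\<in>?A. \<forall>a\<in>?A. a \<le> m \<longrightarrow> a = m"
  \<comment> \<open>The order is reversed, so the maximal element that Zorn's lemma provides is a
    minimal functional.\<close>
  proof (rule predicate_Zorn[where P = "\<lambda>q r. r \<le> q"])
    show "partial_order_on ?A (relation_of (\<lambda>q r. r \<le> q) ?A)"
      by (rule partial_order_on_relation_ofI) auto
  next
    fix M assume "M \<in> Chains (relation_of (\<lambda>q r. r \<le> q) ?A)"
    then have M: "\<And>q. q \<in> M \<Longrightarrow> sublinear q \<and> q \<le> p"
      and chain: "\<And>q r. q \<in> M \<Longrightarrow> r \<in> M \<Longrightarrow> q \<le> r \<or> r \<le> q"
      by (auto simp: Chains_def relation_of_def)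
    show "\<exists>u\<in>?A. \<forall>a\<in>M. u \<le> a"
    proof (cases "M = {}")
      case True
      then show ?thesis using p by auto
    next
      case False
      have bdd: "bdd_below ((\<lambda>q. q x) ` M)" for x
      proof (rule bdd_belowI2)
        fix q assume q: "q \<in> M"
        have "- p (- x) \<le> - q (- x)" using M[OF q] by (simp add: le_fun_def)
        also have "\<dots> \<le> q x" using M[OF q] by (simp add: sublinear_minus_le)
        finally show "- p (- x) \<le> q x" .
      qed
      let ?u = "\<lambda>x. INF q\<in>M. q x"
      have lower: "?u \<le> q" if "q \<in> M" for q
        unfolding le_fun_def using that bdd by (auto intro: cINF_lower)
      have "sublinear ?u" using False M chain bdd by (intro sublinear_INF_chain) auto
      moreover have "?u \<le> p"
        using False M lower order_trans by blast
      ultimately show ?thesis using lower by auto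
    qed
  qed
  then show ?thesis using that by auto
qed

text \<open>The witness is \<open>r x = inf {q (x + z) - s | (z, s) \<in> T}\<close>.\<close>

lemma sublinear_inf_convolution:
  fixes q :: "'a::real_vector \<Rightarrow> real" and T :: "('a \<times> real) set"
  assumes q: "sublinear q" and T: "convex T" "cone T" "T \<noteq> {}"
    and below: "\<And>z s. (z, s) \<in> T \<Longrightarrow> s \<le> q z"
  obtains r where "sublinear r" "r \<le> q" "\<And>z s. (z, s) \<in> T \<Longrightarrow> r (- z) \<le> - s"
proof -
  define r where "r x = (INF w\<in>T. q (x + fst w) - snd w)" for x
  have bdd: "bdd_below ((\<lambda>w. q (x + fst w) - snd w) ` T)" for x
  proof (rule bdd_belowI2)
    fix w assume "w \<in> T"
    then have "snd w \<le> q (fst w)" by (simp add: below)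
    also have "q (fst w) \<le> q (x + fst w) + q (- x)"
      using sublinear_add[OF q, of "x + fst w" "- x"] by simp
    finally show "- q (- x) \<le> q (x + fst w) - snd w" by simp
  qed
  have lower: "r x \<le> q (x + z) - s" if "(z, s) \<in> T" for x z s
    unfolding r_def using cINF_lower[OF bdd that] by simp
  have Tadd: "v + w \<in> T" if "v \<in> T" "w \<in> T" for v w
    using T that convex_cone[of T] by blast
  \<comment> \<open>A nonempty cone contains \<open>(0, 0)\<close>, and this point of
    \<open>T\<close> contributes the value \<open>q x\<close> to the infimum.\<close>
  have lower0: "r x \<le> q x" for x
    using lower[of 0 0 x] T(2,3) cone_contains_0[of T] by (simp add: zero_prod_def)
  have "sublinear r"
  proof (rule sublinearI)
    show "r (x + y) \<le> r x + r y" for x y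
    proof -
      have "r (x + y) \<le> (q (x + fst v) - snd v) + (q (y + fst w) - snd w)"
        if "v \<in> T" "w \<in> T" for v w
      proof -
        have "(fst v + fst w, snd v + snd w) \<in> T"
          using Tadd[OF that] by (simp add: plus_prod_def)
        from lower[OF this, of "x + y"]
        have "r (x + y) \<le> q ((x + fst v) + (y + fst w)) - (snd v + snd w)"
          by (simp add: algebra_simps)
        with sublinear_add[OF q, of "x + fst v" "y + fst w"] show ?thesis by linarith
      qed
      then have "r (x + y) - (q (y + fst w) - snd w) \<le> r x" if "w \<in> T" for w
        unfolding r_def[of x] using that
        by (intro cINF_greatest[OF T(3)]) (simp add: diff_le_eq)
      then have "r (x + y) - r x \<le> r y"
        unfolding r_def[of y] by (intro cINF_greatest[OF T(3)]) (smt (verit))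
      then show ?thesis by simp
    qed
    show "r (c *\<^sub>R x) \<le> c * r x" if c: "0 < c" for c x
    proof -
      have "r (c *\<^sub>R x) / c \<le> q (x + fst w) - snd w" if "w \<in> T" for w
      proof -
        have "(c *\<^sub>R fst w, c * snd w) \<in> T"
          using mem_cone[OF T(2) that, of c] c by (simp add: scaleR_prod_def)
        from lower[OF this, of "c *\<^sub>R x"]
        have "r (c *\<^sub>R x) \<le> q (c *\<^sub>R (x + fst w)) - c * snd w"
          by (simp add: scaleR_add_right)
        also have "\<dots> = c * (q (x + fst w) - snd w)"
          using c by (simp add: sublinear_scale[OF q] right_diff_distrib)
        finally show ?thesis using c by (simp add: field_simps)
      qed
      then have "r (c *\<^sub>R x) / c \<le> r x"
        unfolding r_def[of x] by (intro cINF_greatest[OF T(3)])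
      then show ?thesis using c by (simp add: field_simps)
    qed
    show "r 0 \<le> 0" using lower0[of 0] by (simp add: sublinear_zero[OF q])
  qed
  moreover have "r \<le> q" using lower0 by (rule le_funI)
  moreover have "r (- z) \<le> - s" if "(z, s) \<in> T" for z s
    using lower[OF that, of "- z"] by (simp add: sublinear_zero[OF q])
  ultimately show ?thesis using that by blast
qed

text \<open>Convolving \<open>m\<close> with the ray through \<open>(x, m x)\<close> gives a
  sublinear \<open>r \<le> m\<close> with \<open>r (- x) \<le> - m x\<close>. Minimality forces
  \<open>r = m\<close>, so \<open>m\<close> is odd, and an odd sublinear functional is
  linear.\<close>

lemma minimal_sublinear_linear:
  fixes m :: "'a::real_vector \<Rightarrow> real"
  assumes m: "sublinear m" and min: "\<And>q. sublinear q \<Longrightarrow> q \<le> m \<Longrightarrow> q = m"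
  shows "linear m"
proof -
  have minus: "m (- x) = - m x" for x
  proof -
    let ?T = "cone hull {(x, m x)}"
    have "s \<le> m z" if "(z, s) \<in> ?T" for z s
      using that by (auto simp: cone_hull_expl sublinear_scale[OF m])
    then obtain r where "sublinear r" "r \<le> m" "\<And>z s. (z, s) \<in> ?T \<Longrightarrow> r (- z) \<le> - s"
      using sublinear_inf_convolution[OF m, of ?T]
      by (metis cone_cone_hull cone_hull_empty_iff convex_cone_hull convex_singleton
          insert_not_empty)
    moreover from this have "r = m" by (intro min)
    ultimately have "m (- x) \<le> - m x"
      by (simp add: hull_inc)
    with sublinear_minus_le[OF m, of x] show ?thesis by simp
  qed
  show ?thesis
  proof (rule linearI)
    show "m (x + y) = m x + m y" for x y
      using sublinear_add[OF m, of x y] sublinear_add[OF m, of "- x" "- y"]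
        minus[of x] minus[of y] minus[of "x + y"] by simp
    show "m (c *\<^sub>R x) = c *\<^sub>R m x" for c x
      using sublinear_scale[OF m, of "\<bar>c\<bar>" x] minus[of "\<bar>c\<bar> *\<^sub>R x"]
      by (cases "0 \<le> c") auto
  qed
qed

text \<open>A minimal sublinear \<open>m\<close> below the inf-convolution of \<open>q\<close> with
  \<open>T\<close> is linear, so \<open>m (- z) \<le> - s\<close> turns into
  \<open>s \<le> m z\<close>. This form of Hahn-Banach keeps the upper bound \<open>q\<close> and
  the lower bounds from \<open>T\<close> at once.\<close>

theorem mazur_orlicz:
  fixes q :: "'a::real_vector \<Rightarrow> real" and T :: "('a \<times> real) set"
  assumes "sublinear q" "convex T" "cone T" "T \<noteq> {}"
    and "\<And>z s. (z, s) \<in> T \<Longrightarrow> s \<le> q z"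
  obtains f where "linear f" "f \<le> q" "\<And>z s. (z, s) \<in> T \<Longrightarrow> s \<le> f z"
proof -
  obtain r where r: "sublinear r" "r \<le> q" "\<And>z s. (z, s) \<in> T \<Longrightarrow> r (- z) \<le> - s"
    using sublinear_inf_convolution[OF assms] by blast
  obtain m where m: "sublinear m" "m \<le> r" "\<And>q. sublinear q \<Longrightarrow> q \<le> m \<Longrightarrow> q = m"
    using exists_minimal_sublinear[OF r(1)] by blast
  have lin: "linear m" using m(1,3) by (rule minimal_sublinear_linear)
  have "s \<le> m z" if "(z, s) \<in> T" for z s
    using r(3)[OF that] m(2) linear_neg[OF lin, of z] by (smt (verit) le_funD)
  with lin m(2) r(2) that show ?thesis by (meson order_trans)
qed

section \<open>Strict separation of a convex set from zero in a normed space\<close>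

lemma sublinear_norm: "sublinear (norm :: 'a::real_normed_vector \<Rightarrow> real)"
  by (simp add: sublinear_def norm_triangle_ineq)

text \<open>Mazur--Orlicz is applied to the cone over \<open>D \<times> {d}\<close>, where \<open>d\<close> is a lower bound of the norm on \<open>D\<close>.\<close>

theorem strict_separation_zero:
  fixes D :: "'a::real_normed_vector set"
  assumes D: "convex D" "D \<noteq> {}" "0 \<notin> closure D"
  obtains f :: "'a \<Rightarrow>\<^sub>L real" and d where "norm f = 1" "0 < d" "\<And>x. x \<in> D \<Longrightarrow> d \<le> f x"
proof -
  obtain d where d: "0 < d" "\<And>x. x \<in> D \<Longrightarrow> d \<le> norm x"
    using D(3) by (auto simp: closure_approachable not_less)
  let ?T = "cone hull (D \<times> {d})"
  have "convex ?T" using D(1) by (simp add: convex_cone_hull convex_Times)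
  moreover have "?T \<noteq> {}" using D(2) by (auto simp: cone_hull_empty_iff[symmetric])
  moreover have "s \<le> norm z" if "(z, s) \<in> ?T" for z s
    using that d(2) by (auto simp: cone_hull_expl intro!: mult_left_mono)
  ultimately obtain g where g: "linear g" "g \<le> norm" "\<And>z s. (z, s) \<in> ?T \<Longrightarrow> s \<le> g z"
    using mazur_orlicz[OF sublinear_norm, of ?T] cone_cone_hull by blast
  have "\<bar>g x\<bar> \<le> norm x" for x
    using g(2) linear_neg[OF g(1), of x] by (smt (verit) le_funD norm_minus_cancel)
  then have bl: "bounded_linear g"
    using g(1) by (intro bounded_linear_intro[where K = 1]) (auto simp: linear_add linear_scale)
  define h where "h = Blinfun g"
  have h: "blinfun_apply h = g" using bl by (simp add: h_def bounded_linear_Blinfun_apply)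
  have ge: "d \<le> h x" if "x \<in> D" for x
    using g(3)[of x d] that by (simp add: h hull_inc)
  \<comment> \<open>A nonzero \<open>h\<close> can be normalised; its lower bound on
    \<open>D\<close> is divided by the same norm and stays positive.\<close>
  then have "h \<noteq> 0" using D(2) d(1) by fastforce
  then have "0 < norm h" by simp
  then show ?thesis
    using d(1) ge
    by (intro that[of "h /\<^sub>R norm h" "d / norm h"]) (auto simp: blinfun.scaleR_left field_simps)
qed

section \<open>Cones and norm bases\<close>

lemma interior_cone_scale:
  fixes S :: "'a::real_normed_vector set"
  assumes "cone S" "0 < c" "x \<in> interior S"
  shows "c *\<^sub>R x \<in> interior S"
proof (rule interiorI)
  show "open ((*\<^sub>R) c ` interior S)"
    using assms(2) by (intro open_scaling) auto
  show "c *\<^sub>R x \<in> (*\<^sub>R) c ` interior S" using assms(3) by blast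
  show "(*\<^sub>R) c ` interior S \<subseteq> S"
    using assms interior_subset[of S] by (auto intro!: mem_cone)
qed

lemma frontier_cone_scale:
  fixes S :: "'a::real_normed_vector set"
  assumes "cone S" "0 < c" "x \<in> frontier S"
  shows "c *\<^sub>R x \<in> frontier S"
  using assms mem_cone[OF cone_closure[OF assms(1)], of x c] interior_cone_scale[of S "inverse c" "c *\<^sub>R x"]
  by (auto simp: frontier_def)

lemma generated_cone_eq: "generated_cone S = cone hull S"
  by (simp add: generated_cone_def cone_hull_expl)

lemma dist_zero_le: "c \<in> C \<Longrightarrow> dist_zero C \<le> norm c"
  unfolding dist_zero_def by (rule cINF_lower) (auto intro: bdd_belowI2[where m = 0])

lemma dist_zero_nonneg: "C \<noteq> {} \<Longrightarrow> 0 \<le> dist_zero C"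
  unfolding dist_zero_def by (rule cINF_greatest) auto

text \<open>Any such \<open>y\<close> is a multiple of a base point of norm \<open>t\<close>, and
  \<open>t \<le> norm y\<close> makes the factor at least 1, so co-radiance applies.\<close>

lemma norm_base_cone_subset:
  assumes K: "co_radiant K" and t: "norm_base K t"
    and y: "y \<in> cone hull K" "t \<le> norm y"
  shows "y \<in> K"
proof -
  obtain c k where ck: "y = c *\<^sub>R k" "0 \<le> c" "k \<in> K"
    using y(1) by (auto simp: cone_hull_expl)
  obtain l z where lz: "0 < l" "z \<in> K" "norm z = t" "k = l *\<^sub>R z"
    using t ck(3) by (fastforce simp: norm_base_def)
  have "0 < t" using t by (simp add: norm_base_def)
  moreover have "t \<le> (c * l) * t" using y(2) ck lz by simp
  ultimately have "1 \<le> c * l" by simp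
  then have "(c * l) *\<^sub>R z \<in> K" using K lz(2) by (simp add: co_radiant_def)
  then show ?thesis using ck(1) lz(4) by simp
qed

text \<open>The condition \<open>e * t < norm x\<close> is open, so intersecting it with the
  interior of the cone gives an open neighbourhood of \<open>y\<close>; rescaling by
  \<open>inverse e\<close> reduces its inclusion in \<open>scaled K e\<close> to the previous
  lemma.\<close>

lemma norm_base_interior_scaled:
  fixes K :: "'a::real_normed_vector set"
  assumes K: "co_radiant K" and t: "norm_base K t" and e: "0 < e"
    and y: "y \<in> interior (cone hull K)" "e * t < norm y"
  shows "y \<in> interior (scaled K e)"
proof (rule interiorI)
  let ?U = "interior (cone hull K) \<inter> {x. e * t < norm x}"
  show "open ?U" by (intro open_Int open_interior open_Collect_less continuous_intros)
  show "y \<in> ?U" using y by simp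
  show "?U \<subseteq> scaled K e"
  proof
    fix x assume "x \<in> ?U"
    then have x: "x \<in> cone hull K" "e * t < norm x" using interior_subset by auto
    have "inverse e *\<^sub>R x \<in> K"
      using x e cone_cone_hull[of K]
      by (intro norm_base_cone_subset[OF K t]) (auto intro: mem_cone simp: field_simps)
    then show "x \<in> scaled K e"
      unfolding scaled_def using e by (intro image_eqI[of _ _ "inverse e *\<^sub>R x"]) auto
  qed
qed

lemma scaled_subset_cone_hull: "0 \<le> e \<Longrightarrow> scaled K e \<subseteq> cone hull K"
  by (auto simp: scaled_def intro: mem_cone_hull)

text \<open>Each radius of a norm base is the norm of a point of \<open>K\<close>. With
  \<open>0 < dist_zero K\<close> this makes \<open>norm_base_inf K\<close> positive, so that the
  bound on \<open>eta\<close> in \<open>conically_separated\<close> is a genuine positive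
  number.\<close>

lemma dist_zero_le_norm_base_inf:
  assumes "K \<noteq> {}" "admits_norm_base K"
  shows "dist_zero K \<le> norm_base_inf K"
  unfolding norm_base_inf_def
proof (rule cInf_greatest)
  show "{t. norm_base K t} \<noteq> {}" using assms(2) by (auto simp: admits_norm_base_def)
  fix t assume "t \<in> {t. norm_base K t}"
  then obtain z where "z \<in> K" "norm z = t"
    using assms(1) by (fastforce simp: norm_base_def)
  then show "dist_zero K \<le> t" using dist_zero_le by blast
qed

lemma norm_base_inf_lessE:
  assumes "admits_norm_base K" "norm_base_inf K < c"
  obtains t where "norm_base K t" "t < c"
  using assms cInf_lessD[of "{t. norm_base K t}" c]
  unfolding norm_base_inf_def admits_norm_base_def by blast

section \<open>Separation by a functional minus a multiple of the norm\<close>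

text \<open>For \<open>a \<ge> 0\<close> the function \<open>f - a * norm\<close> is concave; this
  carries bounds from \<open>C\<close> over to its closed convex hull.\<close>

lemma convex_norm_superlevel:
  fixes f :: "'a::real_normed_vector \<Rightarrow>\<^sub>L real"
  assumes a: "0 \<le> a"
  shows "convex {x. c \<le> f x - a * norm x}"
proof (rule convexI)
  fix x y and u v :: real
  assume xy: "x \<in> {x. c \<le> f x - a * norm x}" "y \<in> {x. c \<le> f x - a * norm x}"
    and uv: "0 \<le> u" "0 \<le> v" "u + v = 1"
  have "norm (u *\<^sub>R x + v *\<^sub>R y) \<le> u * norm x + v * norm y"
    using norm_triangle_ineq[of "u *\<^sub>R x" "v *\<^sub>R y"] uv by simp
  from mult_left_mono[OF this a]
  have "u * (f x - a * norm x) + v * (f y - a * norm y)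
      \<le> f (u *\<^sub>R x + v *\<^sub>R y) - a * norm (u *\<^sub>R x + v *\<^sub>R y)"
    by (simp add: blinfun.add_right blinfun.scaleR_right algebra_simps)
  moreover have "u * c + v * c \<le> u * (f x - a * norm x) + v * (f y - a * norm y)"
    using xy uv by (intro add_mono mult_left_mono) auto
  moreover have "u * c + v * c = c" using uv(3) by (metis distrib_right mult_1)
  ultimately show "u *\<^sub>R x + v *\<^sub>R y \<in> {x. c \<le> f x - a * norm x}" by simp
qed

lemma convex_hull_superlevel:
  fixes f :: "'a::real_normed_vector \<Rightarrow>\<^sub>L real"
  assumes "0 \<le> a" "\<And>x. x \<in> C \<Longrightarrow> c \<le> f x - a * norm x" "y \<in> convex hull C"
  shows "c \<le> f y - a * norm y"
proof -
  have "convex hull C \<subseteq> {x. c \<le> f x - a * norm x}"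
    using assms(1,2) by (intro hull_minimal convex_norm_superlevel) auto
  then show ?thesis using assms(3) by blast
qed

lemma closure_convex_hull_superlevel:
  fixes f :: "'a::real_normed_vector \<Rightarrow>\<^sub>L real"
  assumes "0 \<le> a" "\<And>x. x \<in> C \<Longrightarrow> c \<le> f x - a * norm x" "y \<in> closure (convex hull C)"
  shows "c \<le> f y - a * norm y"
proof -
  have "convex hull C \<subseteq> {x. c \<le> f x - a * norm x}"
    using convex_hull_superlevel[OF assms(1,2)] by blast
  moreover have "closed {x. c \<le> f x - a * norm x}"
    by (intro closed_Collect_le continuous_intros)
  ultimately have "closure (convex hull C) \<subseteq> {x. c \<le> f x - a * norm x}"
    by (rule closure_minimal)
  then show ?thesis using assms(3) by blast
qed

text \<open>A segment from a point of \<open>S\<close> satisfying the strict inequality to \<open>y\<close> would meet the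
  frontier of \<open>S\<close>, and the strict inequality persists along it by concavity.\<close>

lemma le_norm_outside_interior:
  fixes f :: "'a::real_normed_vector \<Rightarrow>\<^sub>L real"
  assumes a: "0 \<le> a" and k: "k \<in> S" "a * norm k < f k"
    and frontier: "\<And>b. b \<in> frontier S \<Longrightarrow> f b \<le> a * norm b"
    and y: "y \<notin> interior S"
  shows "f y \<le> a * norm y"
proof (rule ccontr)
  assume "\<not> ?thesis"
  then have fy: "a * norm y < f y" by simp
  define c where "c = min (f k - a * norm k) (f y - a * norm y)"
  have "0 < c" using k(2) fy by (simp add: c_def)
  moreover have "c \<le> f x - a * norm x" if "x \<in> closed_segment k y" for x
    using that unfolding segment_convex_hull
    by (rule convex_hull_superlevel[OF a, rotated]) (auto simp: c_def)
  ultimately have seg: "a * norm x < f x" if "x \<in> closed_segment k y" for x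
    using that by fastforce
  have "closed_segment k y \<inter> frontier S \<noteq> {}"
  proof (cases "y \<in> S")
    case True
    then have "y \<in> frontier S" using y closure_subset by (auto simp: frontier_def)
    then show ?thesis by auto
  next
    case False
    then show ?thesis using k(1) by (intro connected_Int_frontier) auto
  qed
  with seg frontier show False by fastforce
qed

text \<open>The Minkowski difference is convex with 0 outside its closure, so a unit functional is
  at least \<open>d\<close> on it. The point 0 adjoined to the second hull gives
  \<open>0 \<le> s\<close>, and homogeneity extends the bounds from the unit sphere to the
  cones.\<close>

lemma SSP_separation:
  fixes C K :: "'a::real_normed_vector set"
  assumes ssp: "SSP C K" and ne: "\<not> C \<subseteq> {0}"
  obtains f :: "'a \<Rightarrow>\<^sub>L real" and s d where "norm f = 1" "0 \<le> s" "0 < d"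
    "\<And>x. x \<in> C \<Longrightarrow> (s + d) * norm x \<le> f x"
    "\<And>x. x \<in> frontier K \<Longrightarrow> f x \<le> s * norm x"
proof -
  let ?A = "convex hull (C \<inter> sphere 0 1)"
  let ?B = "convex hull ((frontier K \<inter> sphere 0 1) \<union> {0})"
  let ?D = "{a - b | a b. a \<in> ?A \<and> b \<in> ?B}"
  have cones: "cone C" "cone K" and zero: "0 \<notin> closure ?D" using ssp by (auto simp: SSP_def)
  have unit: "inverse (norm x) *\<^sub>R x \<in> C \<inter> sphere 0 1" if "x \<in> C" "x \<noteq> 0" for x
    using that cones(1) by (auto intro: mem_cone)
  then obtain a0 where a0: "a0 \<in> ?A" using ne hull_inc by (metis singletonI subsetI)
  have b0: "0 \<in> ?B" by (simp add: hull_inc)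
  \<comment> \<open>The difference set is rewritten into the shape that
    \<open>convex_differences\<close> expects.\<close>
  have "?D = (\<Union>x\<in>?A. \<Union>y\<in>?B. {x - y})" by auto
  then have "convex ?D" by (simp add: convex_differences convex_convex_hull)
  moreover have "?D \<noteq> {}" using a0 b0 by blast
  ultimately obtain f :: "'a \<Rightarrow>\<^sub>L real" and d
    where f: "norm f = 1" and d: "0 < d" and fd: "\<And>x. x \<in> ?D \<Longrightarrow> d \<le> f x"
    using strict_separation_zero[OF _ _ zero] by blast
  have sep: "f b + d \<le> f a" if "a \<in> ?A" "b \<in> ?B" for a b
    using fd[of "a - b"] that by (fastforce simp: blinfun.diff_right)
  \<comment> \<open>The infimum over \<open>?A\<close> is at least \<open>d\<close> above every
    value on \<open>?B\<close>; subtracting \<open>d\<close> gives one threshold for both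
    sides.\<close>
  define s where "s = (INF a\<in>?A. f a) - d"
  have bdd: "bdd_below (blinfun_apply f ` ?A)"
    using sep[OF _ b0] by (intro bdd_belowI2[where m = d]) (simp add: blinfun.zero_right)
  have A: "s + d \<le> f a" if "a \<in> ?A" for a
    unfolding s_def using cINF_lower[OF bdd that] by simp
  have B: "f b \<le> s" if "b \<in> ?B" for b
  proof -
    have "f b + d \<le> (INF a\<in>?A. f a)" using a0 sep that by (intro cINF_greatest) auto
    then show ?thesis by (simp add: s_def)
  qed
  show ?thesis
  proof (rule that[OF f _ d])
    show "0 \<le> s" using B[OF b0] by (simp add: blinfun.zero_right)
    show "(s + d) * norm x \<le> f x" if "x \<in> C" for x
    proof (cases "x = 0")
      case False
      with A[OF hull_inc[OF unit[OF that False]]] show ?thesis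
        by (simp add: blinfun.scaleR_right field_simps)
    qed (simp add: blinfun.zero_right)
    show "f x \<le> s * norm x" if "x \<in> frontier K" for x
    proof (cases "x = 0")
      case False
      then have "inverse (norm x) *\<^sub>R x \<in> frontier K \<inter> sphere 0 1"
        using that cones(2) by (auto intro: frontier_cone_scale)
      then have "inverse (norm x) *\<^sub>R x \<in> ?B" by (intro hull_inc) blast
      from B[OF this] False show ?thesis
        by (simp add: blinfun.scaleR_right field_simps)
    qed (simp add: blinfun.zero_right)
  qed
qed

section \<open>The two implications between the SSP and conical separation\<close>

lemma SSP_imp_conically_separated:
  fixes C K :: "'a::real_normed_vector set"
  assumes C: "co_radiant C" "0 < dist_zero C" and K: "co_radiant K" "0 < dist_zero K"
    and base: "admits_norm_base K" and meet: "closure (convex hull C) \<inter> K \<noteq> {}"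
    and ssp: "SSP (cone hull C) (cone hull K)"
  shows "conically_separated C K"
proof -
  have normC: "dist_zero C \<le> norm y" if "y \<in> C" for y using that by (rule dist_zero_le)
  obtain c where c: "c \<in> C" using C(1) by (auto simp: co_radiant_def)
  have "\<not> cone hull C \<subseteq> {0}"
    using c normC[OF c] C(2) hull_inc[of c C cone] by auto
  then obtain f :: "'a \<Rightarrow>\<^sub>L real" and s d where f: "norm f = 1" and s: "0 \<le> s" and d: "0 < d"
    and fC: "\<And>x. x \<in> cone hull C \<Longrightarrow> (s + d) * norm x \<le> f x"
    and fK: "\<And>x. x \<in> frontier (cone hull K) \<Longrightarrow> f x \<le> s * norm x"
    using SSP_separation[OF ssp] by blast
  \<comment> \<open>The middle third of the gap: \<open>a1\<close> is positive even when
    \<open>s = 0\<close>, and \<open>a2\<close> stays \<open>d / 3\<close> below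
    \<open>s + d\<close>, which bounds \<open>V\<close> below by a positive number.\<close>
  define a1 where "a1 = s + d / 3"
  define a2 where "a2 = s + 2 * d / 3"
  have a: "0 < a1" "a1 < a2" "s \<le> a1" using s d by (auto simp: a1_def a2_def)
  define V where "V = separation_values f C a1 a2"
  have V: "d / 3 * dist_zero C \<le> v" if vV: "v \<in> V" for v
  proof -
    obtain y b where y: "v = f y - b * norm y" "y \<in> C" "b < a2"
      using vV by (auto simp: V_def separation_values_def)
    have "d / 3 * dist_zero C \<le> (s + d - a2) * norm y"
      using normC[OF y(2)] d by (simp add: a2_def)
    also have "\<dots> \<le> (s + d - b) * norm y" using y(3) by (intro mult_right_mono) auto
    also have "\<dots> \<le> v" using fC[OF hull_inc[OF y(2)]] y(1) by (simp add: algebra_simps)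
    finally show ?thesis .
  qed
  have bdd: "bdd_below V" using V by (rule bdd_belowI)
  define lam where "lam = Inf V"
  have "f c - (a1 + a2) / 2 * norm c \<in> V"
    unfolding V_def separation_values_def using c a
    by (intro CollectI exI[of _ c] exI[of _ "(a1 + a2) / 2"]) auto
  then have "d / 3 * dist_zero C \<le> lam"
    unfolding lam_def using V by (intro cInf_greatest) auto
  then have lam: "0 < lam" using d C(2) by (smt (verit) mult_pos_pos divide_pos_pos)
  have lower: "lam < f y - b * norm y" if y: "y \<in> closure (convex hull C)" and b: "b \<in> {a1<..<a2}"
    for y b
  proof -
    \<comment> \<open>The infimum gives only a weak inequality. Using it at a larger slope
      \<open>b'\<close> and then returning to \<open>b\<close> makes it strict, since
      \<open>y\<close> is nonzero.\<close>
    define b' where "b' = (b + a2) / 2"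
    have b': "b < b'" "b' \<in> {a1<..<a2}" using b by (auto simp: b'_def)
    have "lam \<le> f x - b' * norm x" if "x \<in> C" for x
      unfolding lam_def using that b' bdd
      by (intro cInf_lower) (auto simp: V_def separation_values_def)
    moreover have "0 \<le> b'" using b' a by simp
    ultimately have le: "lam \<le> f y - b' * norm y"
      using closure_convex_hull_superlevel y by blast
    with lam have "y \<noteq> 0" by (auto simp: blinfun.zero_right)
    then have "b * norm y < b' * norm y" using b' by simp
    with le show ?thesis by simp
  qed
  obtain k where k: "k \<in> closure (convex hull C)" "k \<in> K" using meet by blast
  have upper: "f y - b * norm y < lam"
    if eta: "0 < eta" "eta < lam / norm_base_inf K" and b: "b \<in> {a1<..<a2}"
      and y: "y \<notin> interior (scaled K eta)" for eta b y
  proof (cases "y \<in> interior (cone hull K)")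
    case True
    have "K \<noteq> {}" using K(1) by (simp add: co_radiant_def)
    then have "0 < norm_base_inf K"
      using dist_zero_le_norm_base_inf[OF _ base] K(2) by simp
    \<comment> \<open>The infimum need not be attained, but the strict inequality leaves room for an
      actual radius \<open>t\<close> with \<open>eta * t < lam\<close>.\<close>
    then have "norm_base_inf K < lam / eta" using eta by (simp add: field_simps)
    then obtain t where t: "norm_base K t" "t < lam / eta"
      using norm_base_inf_lessE[OF base] by blast
    have "norm y \<le> eta * t"
      using norm_base_interior_scaled[OF K(1) t(1) eta(1) True] y by force
    also have "\<dots> < lam" using t(2) eta(1) by (simp add: field_simps)
    finally have "norm y < lam" .
    moreover have "f y \<le> norm y" using norm_blinfun[of f y] f by simp
    moreover have "0 \<le> b * norm y" using b a by simp
    ultimately show ?thesis by linarith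
  next
    case False
    have "f y \<le> b * norm y"
    proof (rule le_norm_outside_interior[OF _ _ _ _ False])
      show "0 \<le> b" using b a by simp
      show "k \<in> cone hull K" using k(2) by (rule hull_inc)
      show "b * norm k < f k" using lower[OF k(1) b] lam by simp
      show "f x \<le> b * norm x" if "x \<in> frontier (cone hull K)" for x
        using fK[OF that] mult_right_mono[of s b "norm x"] a b by simp
    qed
    then show ?thesis using lam by simp
  qed
  show ?thesis
    unfolding conically_separated_def
  proof (rule exI[of _ a1], rule exI[of _ a2], rule exI[of _ f], rule exI[of _ lam], intro conjI)
    show "\<forall>eta. 0 < eta \<and> eta < lam / norm_base_inf K \<longrightarrow>
           (\<forall>a\<in>{a1<..<a2}. \<forall>y'\<in>UNIV - interior (scaled K eta). \<forall>y\<in>closure (convex hull C).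
              f y' - a * norm y' < lam \<and> lam < f y - a * norm y)"
      using lower upper by blast
  qed (use a f bdd lam in \<open>auto simp: V_def lam_def\<close>)
qed

lemma conically_separated_imp_SSP:
  fixes C K :: "'a::real_normed_vector set"
  assumes C: "C \<noteq> {}" and K: "co_radiant K" "0 < dist_zero K"
    and base: "admits_norm_base K" and sep: "conically_separated C K"
  shows "SSP (cone hull C) (cone hull K)"
proof -
  obtain a1 a2 lam and f :: "'a \<Rightarrow>\<^sub>L real"
    where a: "0 < a1" "a1 < a2" and lam: "0 < lam"
      and *: "\<And>eta b y' y. 0 < eta \<Longrightarrow> eta < lam / norm_base_inf K \<Longrightarrow> b \<in> {a1<..<a2} \<Longrightarrow>
        y' \<notin> interior (scaled K eta) \<Longrightarrow> y \<in> closure (convex hull C) \<Longrightarrow>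
          f y' - b * norm y' < lam \<and> lam < f y - b * norm y"
    using sep unfolding conically_separated_def by (metis DiffI UNIV_I)
  have "K \<noteq> {}" using K(1) by (simp add: co_radiant_def)
  then have "0 < norm_base_inf K"
    using dist_zero_le_norm_base_inf[OF _ base] K(2) by simp
  then obtain eta where eta: "0 < eta" "eta < lam / norm_base_inf K"
    using dense lam by (metis divide_pos_pos)
  have C_ge: "a2 * norm x \<le> f x" if "x \<in> cone hull C" for x
  proof -
    obtain c y where y: "x = c *\<^sub>R y" "0 \<le> c" "y \<in> C"
      using \<open>x \<in> cone hull C\<close> by (auto simp: cone_hull_expl)
    have yhull: "y \<in> closure (convex hull C)"
      using y(3) closure_subset hull_inc by (metis subsetD)
    have "a2 * norm y \<le> f y"
    proof (cases "y = 0")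
      case False
      have "b \<le> f y / norm y" if "a1 < b" "b < a2" for b
      proof -
        \<comment> \<open>The fact \<open>*\<close> delivers both inequalities for a pair of points,
          so an admissible \<open>y'\<close> must be exhibited; 0 serves because it is not in
          \<open>K\<close>.\<close>
        have "0 \<notin> interior (scaled K eta)"
        proof
          assume "0 \<in> interior (scaled K eta)"
          then have "0 \<in> K" using interior_subset eta(1) by (fastforce simp: scaled_def)
          then show False using dist_zero_le[of 0 K] K(2) by simp
        qed
        then have "lam < f y - b * norm y" using *[OF eta] that yhull by simp
        then show ?thesis using lam False by (simp add: field_simps)
      qed
      \<comment> \<open>The slope \<open>b\<close> ranges over the open interval only, so the
        endpoint \<open>a2\<close> is reached by density; \<open>a1\<close> is reached likewise
        below.\<close>
      then have "a2 \<le> f y / norm y" using a(2) by (rule dense_le_bounded[rotated])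
      then show ?thesis using False by (simp add: field_simps)
    qed (simp add: blinfun.zero_right)
    then show ?thesis
      using y(1,2) mult_left_mono[of "a2 * norm y" "f y" c]
      by (simp add: blinfun.scaleR_right algebra_simps)
  qed
  have K_le: "f x \<le> a1 * norm x" if x: "x \<in> frontier (cone hull K)" for x
  proof (cases "x = 0")
    case False
    have "f x / norm x \<le> b" if b: "a1 < b" "b < a2" for b
    proof (rule ccontr)
      assume "\<not> f x / norm x \<le> b"
      then have pos: "0 < f x - b * norm x" using False by (simp add: field_simps)
      \<comment> \<open>This scaling makes the value of \<open>f - b * norm\<close> at
        \<open>r *\<^sub>R x\<close> exactly \<open>lam\<close>, contradicting the strict upper
        bound outside the interior of \<open>scaled K eta\<close>.\<close>
      define r where "r = lam / (f x - b * norm x)"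
      have "0 < r" using lam pos by (simp add: r_def)
      then have "r *\<^sub>R x \<in> frontier (cone hull K)"
        using x by (intro frontier_cone_scale cone_cone_hull)
      then have "r *\<^sub>R x \<notin> interior (scaled K eta)"
        using interior_mono[OF scaled_subset_cone_hull[of eta K]] eta(1)
        by (auto simp: frontier_def)
      moreover obtain y where "y \<in> closure (convex hull C)"
        using C by (metis closure_eq_empty convex_hull_eq_empty ex_in_conv)
      ultimately have "f (r *\<^sub>R x) - b * norm (r *\<^sub>R x) < lam"
        using *[OF eta, of b "r *\<^sub>R x" y] b by auto
      moreover have "f (r *\<^sub>R x) - b * norm (r *\<^sub>R x) = r * (f x - b * norm x)"
        using \<open>0 < r\<close> by (simp add: blinfun.scaleR_right algebra_simps)
      ultimately show False using pos by (simp add: r_def)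
    qed
    then have "f x / norm x \<le> a1" using a(2) by (rule dense_ge_bounded[rotated])
    then show ?thesis using False by (simp add: field_simps)
  qed (simp add: blinfun.zero_right)
  let ?A = "convex hull (cone hull C \<inter> sphere 0 1)"
  let ?B = "convex hull ((frontier (cone hull K) \<inter> sphere 0 1) \<union> {0})"
  let ?D = "{p - q | p q. p \<in> ?A \<and> q \<in> ?B}"
  \<comment> \<open>Here \<open>order_refl\<close> sets the slope in the superlevel lemma to 0,
    leaving a half-space of \<open>f\<close>; the bound on \<open>?B\<close> uses \<open>- f\<close>
    in the same way.\<close>
  have A: "a2 \<le> f p" if "p \<in> ?A" for p
    using convex_hull_superlevel[OF order_refl _ that, of a2 f] C_ge by force
  have B: "f q \<le> a1" if "q \<in> ?B" for q
    using convex_hull_superlevel[OF order_refl _ that, of "- a1" "- f"] K_le a(1)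
    by (force simp: blinfun.minus_left blinfun.zero_right)
  have "?D \<subseteq> {x. a2 - a1 \<le> f x}"
  proof
    fix x assume "x \<in> ?D"
    then obtain p q where "x = p - q" "p \<in> ?A" "q \<in> ?B" by blast
    then show "x \<in> {x. a2 - a1 \<le> f x}"
      using A[of p] B[of q] by (simp add: blinfun.diff_right)
  qed
  moreover have "closed {x. a2 - a1 \<le> f x}"
    by (intro closed_Collect_le continuous_intros)
  ultimately have "closure ?D \<subseteq> {x. a2 - a1 \<le> f x}" by (rule closure_minimal)
  then have "0 \<notin> closure ?D" using a(2) by (auto simp: blinfun.zero_right)
  then show ?thesis by (simp add: SSP_def cone_cone_hull)
qed

theorem theorem4p6:
  fixes C K :: "'a::real_normed_vector set"
  assumes "co_radiant C" and "co_radiant K"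
    and "dist_zero C * dist_zero K > 0"
    and "admits_norm_base K"
    and "closure (convex hull C) \<inter> K \<noteq> {}"
  shows "(SSP (generated_cone C) (generated_cone K) \<longrightarrow> conically_separated C K) \<and>
    (admits_norm_base C \<longrightarrow>
      (conically_separated C K \<longrightarrow> SSP (generated_cone C) (generated_cone K)))"
proof -
  \<comment> \<open>Both distances are nonnegative, so a positive product makes each of them
    positive.\<close>
  have "C \<noteq> {}" "0 < dist_zero C" "0 < dist_zero K"
    using assms(1-3) dist_zero_nonneg[of C] dist_zero_nonneg[of K]
    by (auto simp: co_radiant_def zero_less_mult_iff)
  with assms show ?thesis
    unfolding generated_cone_eq
    using SSP_imp_conically_separated conically_separated_imp_SSP by blast
qed

end
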